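(* There is an absolute constant $B>0$ such that the following holds. Let $f$ be a real-valued $C^3$ function on an interval $[a,b]$ such that $\{x\in[a,b]: f'''(x)=0\}$ is finite, and let $\phi$ be a $C^1$ function on $[a,b]$. Let $J$ denote the (finite) set of points $x\in[a,b]$ for which $f'(x)\ne 0$ and for which at least one of the following holds: $x=a$, $x=b$, $f''(x)=0$, or $f'''(x)=0$. Then $$\left|\int_a^b e^{if(x)}\phi(x)\,dx\right| \le B\big(\|\phi\|_{L^\infty}+\|\phi'\|_{L^1}\big)\left(\int_a^b \min\left(1,\left|\frac{f''(x)}{(f'(x))^2}\right|\right)dx+\min\left(b-a,\ \sum_{x\in J}\frac{1}{|f'(x)|}\right)\right).$$
   Context: Derivatives at the endpoints $a$, $b$ are the appropriate one-sided derivatives. The norms $\|\phi\|_{L^\infty}$ and $\|\phi'\|_{L^1}$ are taken over $[a,b]$. At points where $f'(x)=0$ the quantity $\min(1,|f''(x)/(f'(x))^2|)$ is interpreted as $1$. *)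

theory Defs
  imports "HOL-Analysis.Analysis" "HOL-Probability.Essential_Supremum"
begin

(* Taking the derivative within S makes it one-sided at the endpoints of S = {a..b}. *)
definition deriv_on :: "real set \<Rightarrow> (real \<Rightarrow> 'a::real_normed_vector) \<Rightarrow> real \<Rightarrow> 'a" where
  "deriv_on S f x = vector_derivative f (at x within S)"

definition C_k_on :: "nat \<Rightarrow> real set \<Rightarrow> (real \<Rightarrow> 'a::real_normed_vector) \<Rightarrow> bool" where
  "C_k_on k S f \<longleftrightarrow>
     (\<forall>j<k. \<forall>x\<in>S. (deriv_on S ^^ j) f differentiable (at x within S)) \<and>
     continuous_on S ((deriv_on S ^^ k) f)"

definition Linf_norm :: "real set \<Rightarrow> (real \<Rightarrow> 'a::real_normed_vector) \<Rightarrow> real" where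
  "Linf_norm S g = real_of_ereal (esssup (lebesgue_on S) (\<lambda>x. ereal (norm (g x))))"

definition L1_norm :: "real set \<Rightarrow> (real \<Rightarrow> 'a::real_normed_vector) \<Rightarrow> real" where
  "L1_norm S g = integral\<^sup>L (lebesgue_on S) (\<lambda>x. norm (g x))"

(* The case split overrides HOL's x / 0 = 0, which would give min 1 0 = 0. *)
definition min_ratio :: "real \<Rightarrow> real \<Rightarrow> real" where
  "min_ratio d1 d2 = (if d1 = 0 then 1 else min 1 \<bar>d2 / d1\<^sup>2\<bar>)"

definition J_set :: "real \<Rightarrow> real \<Rightarrow> (real \<Rightarrow> real) \<Rightarrow> real set" where
  "J_set a b f = {x \<in> {a..b}. deriv_on {a..b} f x \<noteq> 0 \<and>
     (x = a \<or> x = b \<or> (deriv_on {a..b} ^^ 2) f x = 0 \<or> (deriv_on {a..b} ^^ 3) f x = 0)}"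

lemma deriv_on_has_vector_derivative:
  assumes "f differentiable (at x within S)"
  shows "(f has_vector_derivative deriv_on S f x) (at x within S)"
  using assms by (simp add: deriv_on_def vector_derivative_works)

lemma C_k_on_has_vector_derivative:
  assumes "C_k_on k S f" "j < k" "x \<in> S"
  shows "((deriv_on S ^^ j) f has_vector_derivative (deriv_on S ^^ Suc j) f x) (at x within S)"
  using assms deriv_on_has_vector_derivative[of "(deriv_on S ^^ j) f" x S]
  by (auto simp: C_k_on_def)

lemma deriv_on_eq:
  assumes "a < b" "x \<in> {a..b}" "(f has_vector_derivative d) (at x within {a..b})"
  shows "deriv_on {a..b} f x = d"
  using vector_derivative_within_cbox[OF assms(1), of x f d] assms by (simp add: deriv_on_def)

lemma finite_zeros_of_finite_deriv_zeros:
  fixes g g' :: "real \<Rightarrow> real"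
  assumes der: "\<And>x. x \<in> {a..b} \<Longrightarrow> (g has_vector_derivative g' x) (at x within {a..b})"
    and fin: "finite {x \<in> {a..b}. g' x = 0}"
  shows "finite {x \<in> {a..b}. g x = 0}"
proof (rule ccontr)
  let ?Z = "{x \<in> {a..b}. g' x = 0}"
  assume inf: "infinite {x \<in> {a..b}. g x = 0}"
  define h where "h = (\<lambda>x. card {z \<in> ?Z. z < x})"
  have lt: "h x < h y" if "x \<in> {a..b}" "y \<in> {a..b}" "g x = 0" "g y = 0" "x < y" for x y
  proof -
    have cont: "continuous_on {x..y} g"
      using der that
      by (intro continuous_on_subset[of "{a..b}" g "{x..y}"] continuous_on_vector_derivative)
         auto
    have d: "(g has_derivative (\<lambda>t. t * g' z)) (at z)" if "x < z" "z < y" for z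
    proof -
      have "z \<in> interior {a..b}"
        using that \<open>x \<in> {a..b}\<close> \<open>y \<in> {a..b}\<close> by simp
      then show ?thesis
        using der[of z] at_within_interior[of z "{a..b}"] interior_subset[of "{a..b}"]
        by (auto simp: has_vector_derivative_def)
    qed
    have "g x = g y" using that by simp
    then have "\<exists>z>x. z < y \<and> (\<lambda>t. t * g' z) = (\<lambda>v. 0)"
      using Rolle_deriv[OF \<open>x < y\<close> _ cont, of "\<lambda>z t. t * g' z"] d by blast
    then obtain z where z: "x < z" "z < y" "(\<lambda>t. t * g' z) = (\<lambda>v. 0)" by blast
    have "g' z = 0" using fun_cong[OF z(3), of 1] by simp
    then have "z \<in> {z \<in> ?Z. z < y}" "z \<notin> {z \<in> ?Z. z < x}" using z that by auto
    moreover have "{z \<in> ?Z. z < x} \<subseteq> {z \<in> ?Z. z < y}" using that by auto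
    ultimately have "{z \<in> ?Z. z < x} \<subset> {z \<in> ?Z. z < y}" by blast
    moreover have "finite {z \<in> ?Z. z < y}" using fin by (rule rev_finite_subset) auto
    ultimately show ?thesis unfolding h_def by (rule psubset_card_mono[rotated])
  qed
  have inj: "inj_on h {x \<in> {a..b}. g x = 0}"
    by (rule linorder_inj_onI) (use lt in \<open>auto simp: less_le\<close>)
  have le: "h x \<le> card ?Z" for x
    unfolding h_def by (rule card_mono[OF fin]) blast
  have "h ` {x \<in> {a..b}. g x = 0} \<subseteq> {..card ?Z}"
    by (rule image_subsetI) (simp only: atMost_iff le)
  then have "finite {x \<in> {a..b}. g x = 0}"
    by (rule inj_on_finite[OF inj _ finite_atMost])
  with inf show False by contradiction
qed

(* In particular the sum over J_set in the main estimate is a genuine finite sum. *)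
lemma finite_J_set:
  assumes "C_k_on 3 {a..b} f" "finite {x \<in> {a..b}. (deriv_on {a..b} ^^ 3) f x = 0}"
  shows "finite (J_set a b f)"
proof -
  let ?D = "\<lambda>j. (deriv_on {a..b} ^^ j) f"
  have "(?D 2 has_vector_derivative ?D 3 x) (at x within {a..b})" if "x \<in> {a..b}" for x
    using C_k_on_has_vector_derivative[OF assms(1) _ that, of 2] by (simp only: eval_nat_numeral)
  then have "finite {x \<in> {a..b}. ?D 2 x = 0}"
    using assms(2) by (rule finite_zeros_of_finite_deriv_zeros)
  then have "finite ({a, b} \<union> {x \<in> {a..b}. ?D 2 x = 0} \<union> {x \<in> {a..b}. ?D 3 x = 0})"
    using assms(2) by simp
  then show ?thesis
    by (rule rev_finite_subset) (unfold J_set_def, blast)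
qed

lemma borel_measurable_min_ratio:
  assumes [measurable]: "g \<in> borel_measurable M" "h \<in> borel_measurable M"
  shows "(\<lambda>x. min_ratio (g x) (h x)) \<in> borel_measurable M"
  unfolding min_ratio_def by measurable

(* Likewise the integral of min_ratio in the main estimate exists. *)
lemma integrable_min_ratio:
  assumes "C_k_on 3 {a..b} f"
  shows "(\<lambda>x. min_ratio (deriv_on {a..b} f x) ((deriv_on {a..b} ^^ 2) f x)) integrable_on {a..b}"
proof -
  let ?D = "\<lambda>j. (deriv_on {a..b} ^^ j) f"
  have c: "continuous_on {a..b} (?D j)" if "j < 3" for j
    using C_k_on_has_vector_derivative[OF assms that]
    by (intro continuous_on_vector_derivative) auto
  have m: "?D j \<in> borel_measurable (lebesgue_on {a..b})" if "j < 3" for j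
    using c[OF that] by (intro continuous_imp_measurable_on_sets_lebesgue) auto
  have "(\<lambda>x. min_ratio (?D 1 x) (?D 2 x)) integrable_on {a..b}"
  proof (rule measurable_bounded_by_integrable_imp_integrable_real[where g = "\<lambda>_. 1"])
    show "(\<lambda>x. min_ratio (?D 1 x) (?D 2 x)) \<in> borel_measurable (lebesgue_on {a..b})"
      by (intro borel_measurable_min_ratio m) auto
    show "(\<lambda>_. 1::real) integrable_on {a..b}" by (rule integrable_const_ivl)
    show "\<bar>min_ratio (?D 1 x) (?D 2 x)\<bar> \<le> 1" for x by (auto simp: min_ratio_def)
    show "{a..b} \<in> sets lebesgue" by simp
  qed
  then show ?thesis by simp
qed

end

theory Submission
  imports Defs
begin

text \<open>
  Cut \<open>[a, b]\<close> at the zeros of \<open>f'\<close>, \<open>f''\<close> and \<open>f'''\<close>. On a piece where \<open>f'\<close> does not vanish at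
  either end, \<open>1 / f'\<close> is monotone and one integration by parts bounds the integral by the values
  of \<open>1 / \<bar>f'\<bar>\<close> at the ends. If \<open>f'\<close> vanishes at one end, then it does not at the other, and a
  neighbourhood of the zero is first cut off at a point \<open>e\<close>, chosen such that both the length of the
  neighbourhood and \<open>1 / \<bar>f' e\<bar>\<close> are at most the integral of \<open>min 1 \<bar>f'' / f'\<^sup>2\<bar>\<close> plus the value of
  \<open>1 / \<bar>f'\<bar>\<close> at the other end. The pieces are then summed; no two share more than an end point, so
  every point of \<open>J\<close> is counted at most twice.
\<close>

section \<open>Signs and growth read off from derivatives\<close>

text \<open>Intermediate value theorem. Zeros at \<open>c\<close> and \<open>d\<close> are allowed
  because the points at which \<open>[a, b]\<close> is cut are themselves zeros of
  \<open>f'\<close>, \<open>f''\<close> or \<open>f'''\<close>; hence the weak inequalities.\<close>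

lemma nonvanishing_imp_constant_sign:
  fixes u :: "real \<Rightarrow> real"
  assumes "continuous_on {c..d} u" "\<And>x. c < x \<Longrightarrow> x < d \<Longrightarrow> u x \<noteq> 0"
  shows "(\<forall>x\<in>{c..d}. 0 \<le> u x) \<or> (\<forall>x\<in>{c..d}. u x \<le> 0)"
proof (rule ccontr)
  assume "\<not> ?thesis"
  then obtain x y where xy: "x \<in> {c..d}" "y \<in> {c..d}" "u x < 0" "0 < u y"
    by (auto simp: not_le)
  \<comment> \<open>The order of \<open>x\<close> and \<open>y\<close> is unknown;
    \<open>closed_segment\<close> avoids a case split.\<close>
  have "closed_segment x y \<subseteq> {c..d}"
    using xy by (auto simp: closed_segment_eq_real_ivl)
  then have "continuous_on (closed_segment x y) u"
    using assms(1) continuous_on_subset by blast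
  moreover have "0 \<in> closed_segment (u x) (u y)"
    using xy by (simp add: closed_segment_eq_real_ivl)
  ultimately obtain z where z: "z \<in> closed_segment x y" "u z = 0"
    using IVT'_closed_segment_real by blast
  with xy have "z \<noteq> x" "z \<noteq> y" by auto
  with z xy have "c < z" "z < d"
    by (auto simp: closed_segment_eq_real_ivl split: if_splits)
  with assms(2) z show False by blast
qed

lemma has_integral_derivative_subinterval:
  fixes g k :: "real \<Rightarrow> real"
  assumes "\<And>x. x \<in> {c..d} \<Longrightarrow> (g has_real_derivative k x) (at x within {c..d})"
    and "c \<le> x" "x \<le> y" "y \<le> d"
  shows "(k has_integral g y - g x) {x..y}"
proof (rule fundamental_theorem_of_calculus[OF assms(3)])
  fix z assume "z \<in> {x..y}"
  with assms(2,4) have "z \<in> {c..d}" "{x..y} \<subseteq> {c..d}" by auto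
  then show "(g has_vector_derivative k z) (at z within {x..y})"
    using DERIV_subset[OF assms(1)] by (simp flip: has_real_derivative_iff_has_vector_derivative)
qed

lemma derivative_nonneg_imp_le:
  fixes g k :: "real \<Rightarrow> real"
  assumes "\<And>x. x \<in> {c..d} \<Longrightarrow> (g has_real_derivative k x) (at x within {c..d})"
    and "\<And>x. x \<in> {c..d} \<Longrightarrow> 0 \<le> k x" and "c \<le> x" "x \<le> y" "y \<le> d"
  shows "g x \<le> g y"
  using has_integral_nonneg[OF has_integral_derivative_subinterval[OF assms(1,3-5)]] assms(2-5)
  by simp

lemma derivative_le_imp_increment_le:
  fixes g k :: "real \<Rightarrow> real"
  assumes "\<And>x. x \<in> {c..d} \<Longrightarrow> (g has_real_derivative k x) (at x within {c..d})"
    and "c \<le> x" "x \<le> y" "y \<le> d" and "\<And>z. z \<in> {x..y} \<Longrightarrow> k z \<le> m"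
  shows "g y - g x \<le> m * (y - x)"
  using has_integral_le[OF has_integral_derivative_subinterval[OF assms(1-4)]
      has_integral_const_real[of m x y]] assms(2-5)
  by (simp add: mult.commute)

section \<open>Integration by parts where \<open>f'\<close> does not vanish\<close>

text \<open>Integration by parts against \<open>1 / g\<close> leaves boundary terms and an integral
  containing \<open>\<phi>' / g\<close> and \<open>\<phi> * k / g\<^sup>2\<close>. As
  \<open>g\<close> is monotone without zeros, \<open>1 / \<bar>g\<bar>\<close> is largest at an end;
  as \<open>k\<close> keeps its sign, the integral of \<open>\<bar>k\<bar> / g\<^sup>2\<close> is,
  up to sign, a difference of end values of \<open>1 / g\<close>.\<close>

lemma first_derivative_test_oscillatory:
  fixes f g k :: "real \<Rightarrow> real" and \<phi> \<phi>' :: "real \<Rightarrow> complex"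
  assumes cd: "c \<le> d"
    and f: "\<And>x. x \<in> {c..d} \<Longrightarrow> (f has_real_derivative g x) (at x within {c..d})"
    and g: "\<And>x. x \<in> {c..d} \<Longrightarrow> (g has_real_derivative k x) (at x within {c..d})"
    and k: "continuous_on {c..d} k"
    and \<phi>: "\<And>x. x \<in> {c..d} \<Longrightarrow> (\<phi> has_vector_derivative \<phi>' x) (at x within {c..d})"
    and \<phi>': "continuous_on {c..d} \<phi>'"
    and nz: "\<And>x. x \<in> {c..d} \<Longrightarrow> g x \<noteq> 0"
    and sgn: "(\<forall>x\<in>{c..d}. 0 \<le> k x) \<or> (\<forall>x\<in>{c..d}. k x \<le> 0)"
    and M: "\<And>x. x \<in> {c..d} \<Longrightarrow> cmod (\<phi> x) \<le> M"
  shows "cmod (integral {c..d} (\<lambda>x. exp (\<i> * complex_of_real (f x)) * \<phi> x))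
    \<le> 2 * (M + integral {c..d} (\<lambda>x. cmod (\<phi>' x))) * (1 / \<bar>g c\<bar> + 1 / \<bar>g d\<bar>)"
proof -
  define W where "W = 1 / \<bar>g c\<bar> + 1 / \<bar>g d\<bar>"
  define V where "V = integral {c..d} (\<lambda>x. cmod (\<phi>' x))"
  define E where "E x = exp (\<i> * complex_of_real (f x))" for x
  \<comment> \<open>\<open>H\<close> has derivative \<open>E x * \<phi> x + r x\<close>: the factor
    \<open>g\<close> that comes from differentiating \<open>E\<close> cancels \<open>1 / g\<close>,
    and \<open>r\<close> collects the other two terms of the product rule.\<close>
  define H where "H x = - \<i> * (E x * \<phi> x * of_real (1 / g x))" for x
  define r where "r x = - \<i> * (E x * \<phi>' x * of_real (1 / g x)
      - E x * \<phi> x * of_real (k x / (g x)\<^sup>2))" for x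
  have cf: "continuous_on {c..d} f" and cg: "continuous_on {c..d} g"
    using f g DERIV_continuous_on by blast+
  have cphi: "continuous_on {c..d} \<phi>"
    using \<phi> by (rule continuous_on_vector_derivative)
  have normE: "cmod (E x) = 1" for x
    by (simp add: E_def)
  have M0: "0 \<le> M" using M[of c] cd order_trans[OF norm_ge_zero] by auto
  \<comment> \<open>The signs \<open>s\<close> of \<open>k\<close> and \<open>t\<close> of
    \<open>g\<close> treat all sign patterns at once.\<close>
  obtain s :: real where s: "s = 1 \<or> s = -1" "\<And>x. x \<in> {c..d} \<Longrightarrow> 0 \<le> s * k x"
    using sgn that[of 1] that[of "-1"] by auto
  have "(\<forall>x\<in>{c..d}. 0 \<le> g x) \<or> (\<forall>x\<in>{c..d}. g x \<le> 0)"
    by (rule nonvanishing_imp_constant_sign[OF cg]) (use nz in auto)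
  then obtain t :: real where t: "t = 1 \<or> t = -1" "\<And>x. x \<in> {c..d} \<Longrightarrow> 0 \<le> t * g x"
    using that[of 1] that[of "-1"] by auto
  have abs_g: "\<bar>g x\<bar> = t * g x" if "x \<in> {c..d}" for x
    using t(1) t(2)[OF that] by auto
  have W: "1 / \<bar>g x\<bar> \<le> W" if x: "x \<in> {c..d}" for x
  proof -
    have der: "((\<lambda>x. s * g x) has_real_derivative s * k x) (at x within {c..d})"
      if "x \<in> {c..d}" for x
      by (rule DERIV_cmult[OF g[OF that]])
    have "s * g c \<le> s * g x" "s * g x \<le> s * g d"
      by (rule derivative_nonneg_imp_le[OF der s(2)]; use x in simp)+
    then have "\<bar>g c\<bar> \<le> \<bar>g x\<bar> \<or> \<bar>g d\<bar> \<le> \<bar>g x\<bar>"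
      using s(1) t(1) abs_g[OF x] abs_g[of c] abs_g[of d] cd by auto
    moreover have "1 / \<bar>g x\<bar> \<le> 1 / \<bar>g y\<bar>" if "y \<in> {c..d}" "\<bar>g y\<bar> \<le> \<bar>g x\<bar>" for y
      by (intro frac_le) (use that nz in auto)
    then have "\<bar>g c\<bar> \<le> \<bar>g x\<bar> \<Longrightarrow> 1 / \<bar>g x\<bar> \<le> 1 / \<bar>g c\<bar>" "\<bar>g d\<bar> \<le> \<bar>g x\<bar> \<Longrightarrow> 1 / \<bar>g x\<bar> \<le> 1 / \<bar>g d\<bar>"
      using cd by auto
    moreover have "0 \<le> 1 / \<bar>g c\<bar>" "0 \<le> 1 / \<bar>g d\<bar>" by simp_all
    ultimately show ?thesis unfolding W_def by linarith
  qed
  have W0: "0 \<le> W" by (simp add: W_def)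
  have Hder: "(H has_vector_derivative E x * \<phi> x + r x) (at x within {c..d})"
    if x: "x \<in> {c..d}" for x
  proof -
    have Ed: "(E has_vector_derivative \<i> * of_real (g x) * E x) (at x within {c..d})"
      unfolding E_def
      by (rule has_vector_derivative_eq_rhs,
          rule field_vector_diff_chain_within[where g = exp and f = "\<lambda>x. \<i> * of_real (f x)", unfolded o_def])
         (auto intro!: derivative_eq_intros has_vector_derivative_mult_right
             has_vector_derivative_of_real f[OF x])
    have gd: "((\<lambda>x. complex_of_real (1 / g x)) has_vector_derivative
        of_real (- k x / (g x)\<^sup>2)) (at x within {c..d})"
      by (intro has_vector_derivative_of_real)
         (auto intro!: derivative_eq_intros g[OF x] simp: nz[OF x] power2_eq_square)
    have "((\<lambda>x. (E x * \<phi> x) * complex_of_real (1 / g x)) has_vector_derivative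
        (E x * \<phi> x) * of_real (- k x / (g x)\<^sup>2)
         + (E x * \<phi>' x + (\<i> * of_real (g x) * E x) * \<phi> x) * of_real (1 / g x)) (at x within {c..d})"
      by (intro has_vector_derivative_mult Ed \<phi>[OF x] gd)
    from has_vector_derivative_mult_right[OF this, of "-\<i>"]
    show ?thesis
      unfolding H_def r_def
      by (rule has_vector_derivative_eq_rhs) (simp add: field_simps nz[OF x])
  qed
  have Hint: "((\<lambda>x. E x * \<phi> x + r x) has_integral H d - H c) {c..d}"
    by (rule fundamental_theorem_of_calculus[OF cd Hder])
  have cr: "continuous_on {c..d} r"
    unfolding r_def E_def
    by (intro continuous_intros cf cg cphi \<phi>' k) (auto simp: nz)
  have rint: "r integrable_on {c..d}"
    by (rule integrable_continuous_real[OF cr])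
  have main: "integral {c..d} (\<lambda>x. E x * \<phi> x) = H d - H c - integral {c..d} r"
    using has_integral_diff[OF Hint integrable_integral[OF rint]] by (simp add: integral_unique)
  \<comment> \<open>Since \<open>\<bar>k\<bar> = s * k\<close>, the second part of the error is
    dominated by an exact derivative.\<close>
  have "((\<lambda>x. - (s / g x)) has_real_derivative s * k x / (g x)\<^sup>2) (at x within {c..d})"
    if x: "x \<in> {c..d}" for x
    by (auto intro!: derivative_eq_intros g[OF x] simp: nz[OF x] power2_eq_square)
  then have "((\<lambda>x. s * k x / (g x)\<^sup>2) has_integral - (s / g d) - - (s / g c)) {c..d}"
    by (rule has_integral_derivative_subinterval) (use cd in auto)
  moreover have "\<bar>k x\<bar> = s * k x" if "x \<in> {c..d}" for x
    using s(1) s(2)[OF that] by auto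
  ultimately have kint: "((\<lambda>x. \<bar>k x\<bar> / (g x)\<^sup>2) has_integral s / g c - s / g d) {c..d}"
    using has_integral_cong[of "{c..d}" "\<lambda>x. \<bar>k x\<bar> / (g x)\<^sup>2" "\<lambda>x. s * k x / (g x)\<^sup>2"] by simp
  have kle: "s / g c - s / g d \<le> W"
  proof -
    have "s / g c \<le> 1 / \<bar>g c\<bar>" "- (s / g d) \<le> 1 / \<bar>g d\<bar>"
      using s(1) by (auto simp: abs_if)
    then show ?thesis unfolding W_def by linarith
  qed
  have pint: "((\<lambda>x. cmod (\<phi>' x)) has_integral V) {c..d}"
    unfolding V_def
    by (intro integrable_integral integrable_continuous_real continuous_intros \<phi>')
  have maj: "((\<lambda>x. W * cmod (\<phi>' x) + M * (\<bar>k x\<bar> / (g x)\<^sup>2)) has_integral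
      W * V + M * (s / g c - s / g d)) {c..d}"
    by (intro has_integral_add has_integral_mult_right pint kint)
  have "cmod (r x) \<le> W * cmod (\<phi>' x) + M * (\<bar>k x\<bar> / (g x)\<^sup>2)" if x: "x \<in> {c..d}" for x
  proof -
    have "cmod (r x) \<le> cmod (\<phi>' x) * (1 / \<bar>g x\<bar>) + cmod (\<phi> x) * (\<bar>k x\<bar> / (g x)\<^sup>2)"
      using norm_triangle_ineq4[of "E x * \<phi>' x * of_real (1 / g x)"
          "E x * \<phi> x * of_real (k x / (g x)\<^sup>2)"]
      by (simp add: r_def norm_mult norm_divide norm_power normE)
    also have "\<dots> \<le> cmod (\<phi>' x) * W + M * (\<bar>k x\<bar> / (g x)\<^sup>2)"
      by (intro add_mono mult_left_mono mult_right_mono W[OF x] M[OF x]) auto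
    finally show ?thesis by (simp add: mult.commute)
  qed
  then have "cmod (integral {c..d} r) \<le> W * V + M * (s / g c - s / g d)"
    using integral_norm_bound_integral[OF rint, of "\<lambda>x. W * cmod (\<phi>' x) + M * (\<bar>k x\<bar> / (g x)\<^sup>2)"]
      maj by (auto simp: has_integral_iff)
  moreover have "M * (s / g c - s / g d) \<le> M * W"
    by (rule mult_left_mono[OF kle M0])
  moreover have "cmod (H x) \<le> M * (1 / \<bar>g x\<bar>)" if x: "x \<in> {c..d}" for x
    using mult_right_mono[OF M[OF x], of "1 / \<bar>g x\<bar>"]
    by (simp add: H_def norm_mult norm_divide normE)
  from this[of c] this[of d] have "cmod (H d - H c) \<le> M * W"
    using cd norm_triangle_ineq4[of "H d" "H c"] by (simp add: W_def distrib_left)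
  moreover have "0 \<le> V" using pint by (rule has_integral_nonneg) auto
  \<comment> \<open>Boundary terms and error add up to at most \<open>2 * M * W + W * V\<close>;
    this rounds it up to \<open>2 * (M + V) * W\<close>.\<close>
  then have "W * V \<ge> 0" using W0 by simp
  ultimately show ?thesis
    using norm_triangle_ineq4[of "H d - H c" "integral {c..d} r"]
    unfolding main[unfolded E_def] W_def[symmetric] V_def[symmetric]
    by (simp add: algebra_simps)
qed

section \<open>The ratio \<open>min_ratio\<close> and the cutoff near a zero of
  \<open>f'\<close>\<close>

lemma min_ratio_nonneg: "0 \<le> min_ratio u v"
  by (simp add: min_ratio_def)

text \<open>This and \<open>min_ratio_minus_right\<close> are the invariances behind two reductions:
  changing the sign of \<open>g\<close> and \<open>k\<close> together, and reflecting the interval,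
  which changes the sign of \<open>k\<close> alone.\<close>

lemma min_ratio_minus: "min_ratio (- u) (- v) = min_ratio u v"
  by (simp add: min_ratio_def)

lemma min_ratio_minus_right: "min_ratio u (- v) = min_ratio u v"
  by (simp add: min_ratio_def)

text \<open>The value 1 prescribed at \<open>u = 0\<close> makes this hold at the zero of
  \<open>g\<close> too, so no end point has to be left out.\<close>

lemma min_ratio_eq_1: "u\<^sup>2 \<le> v \<Longrightarrow> min_ratio u v = 1"
  by (auto simp: min_ratio_def min_def field_simps)

lemma min_ratio_eq_ratio: "u \<noteq> 0 \<Longrightarrow> 0 \<le> v \<Longrightarrow> v \<le> u\<^sup>2 \<Longrightarrow> min_ratio u v = v / u\<^sup>2"
  by (auto simp: min_ratio_def min_def field_simps)

text \<open>Unless \<open>e = d\<close> is chosen, \<open>k\<close> dominates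
  \<open>g\<^sup>2\<close> between \<open>c\<close> and \<open>e\<close>, so the ratio is 1 there
  and its integral measures the length \<open>e - c\<close>. The bound on \<open>1 / g e\<close>
  comes from \<open>1 / g e = e - c\<close> if \<open>k\<close> increases, and from the integral of
  the ratio over \<open>{e..d}\<close> if \<open>k\<close> decreases.\<close>

lemma cutoff_near_zero_pos:
  fixes g k :: "real \<Rightarrow> real"
  assumes cd: "c < d"
    and g: "\<And>x. x \<in> {c..d} \<Longrightarrow> (g has_real_derivative k x) (at x within {c..d})"
    and k: "continuous_on {c..d} k"
    and gc: "g c = 0" and gpos: "\<And>x. c < x \<Longrightarrow> x \<le> d \<Longrightarrow> 0 < g x"
    and kpos: "\<And>x. x \<in> {c..d} \<Longrightarrow> 0 \<le> k x"
    and mono: "mono_on {c..d} k \<or> antimono_on {c..d} k"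
    and int: "(\<lambda>x. min_ratio (g x) (k x)) integrable_on {c..d}"
  defines "R \<equiv> integral {c..d} (\<lambda>x. min_ratio (g x) (k x)) + 1 / g d"
  shows "\<exists>e. c < e \<and> e \<le> d \<and> e - c \<le> R \<and> 1 / g e \<le> R"
proof -
  have cg: "continuous_on {c..d} g" using g DERIV_continuous_on by blast
  have gmono: "g x \<le> g y" if "c \<le> x" "x \<le> y" "y \<le> d" for x y
    using derivative_nonneg_imp_le[OF g kpos] that by blast
  have I0: "0 \<le> integral {x..y} (\<lambda>x. min_ratio (g x) (k x))" if "c \<le> x" "x \<le> y" "y \<le> d" for x y
    by (intro integral_nonneg integrable_subinterval_real[OF int]) (use that in \<open>auto simp: min_ratio_nonneg\<close>)
  have gd: "0 \<le> 1 / g d" using gpos[of d] cd by simp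
  have split: "integral {c..e} (\<lambda>x. min_ratio (g x) (k x)) + integral {e..d} (\<lambda>x. min_ratio (g x) (k x))
      = R - 1 / g d" if "c \<le> e" "e \<le> d" for e
    using Henstock_Kurzweil_Integration.integral_combine[OF that int] by (simp add: R_def)
  have one: "e - c \<le> R - 1 / g d - integral {e..d} (\<lambda>x. min_ratio (g x) (k x))"
    if e: "c \<le> e" "e \<le> d" and dom: "\<And>x. c \<le> x \<Longrightarrow> x \<le> e \<Longrightarrow> (g x)\<^sup>2 \<le> k x" for e
  proof -
    have "integral {c..e} (\<lambda>x. min_ratio (g x) (k x)) = integral {c..e} (\<lambda>x. 1)"
      by (rule integral_cong) (use dom in \<open>auto intro: min_ratio_eq_1\<close>)
    with e split[OF e] show ?thesis by simp
  qed
  from mono show ?thesis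
  proof
    assume km: "mono_on {c..d} k"
    \<comment> \<open>Convexity gives \<open>g x \<le> (x - c) * k x\<close>, so the ratio \<open>k / g\<^sup>2\<close> is at least \<open>1\<close> as long as
      \<open>(x - c) * g x \<le> 1\<close>; the cutoff is where equality holds.\<close>
    show ?thesis
    proof (cases "(d - c) * g d \<le> 1")
      case True
      \<comment> \<open>The interval is no longer than \<open>1 / g d\<close>, so
        \<open>e = d\<close> serves.\<close>
      then have "d - c \<le> 1 / g d" using gpos[of d] cd by (simp add: field_simps)
      moreover have "1 / g d \<le> R" using I0[of c d] cd by (simp add: R_def)
      ultimately show ?thesis using cd by force
    next
      case False
      have "\<exists>e\<ge>c. e \<le> d \<and> (e - c) * g e = 1"
        by (rule IVT'[where f = "\<lambda>x. (x - c) * g x"]) (use False cd in \<open>auto intro!: continuous_intros cg\<close>)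
      then obtain e where e: "c \<le> e" "e \<le> d" "(e - c) * g e = 1" by blast
      then have ce: "c < e" by (cases "c = e") auto
      have "(g x)\<^sup>2 \<le> k x" if x: "c \<le> x" "x \<le> e" for x
      proof -
        have gx: "0 \<le> g x" using gmono[of c x] x e gc by simp
        have "(x - c) * g x \<le> (e - c) * g e"
          by (intro mult_mono gmono gx) (use x e in auto)
        then have le1: "(x - c) * g x \<le> 1" using e by simp
        have "g x - g c \<le> k x * (x - c)"
          by (rule derivative_le_imp_increment_le[OF g])
             (use x e in \<open>auto intro!: mono_onD[OF km]\<close>)
        then have "g x * g x \<le> (k x * (x - c)) * g x"
          using gx gc by (intro mult_right_mono) auto
        also have "\<dots> = k x * ((x - c) * g x)" by simp
        also have "\<dots> \<le> k x" using mult_left_mono[OF le1 kpos[of x]] x e by simp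
        finally show ?thesis by (simp add: power2_eq_square)
      qed
      from one[OF e(1,2) this] have "e - c \<le> R" using I0[OF e(1,2) order_refl] gd by linarith
      moreover have "1 / g e = e - c" using e(3) gpos[OF ce e(2)] by (simp add: field_simps)
      ultimately show ?thesis using ce e(2) by auto
    qed
  next
    assume km: "antimono_on {c..d} k"
    \<comment> \<open>Here \<open>k\<close> decreases while \<open>g\<^sup>2\<close> increases; the cutoff is where they cross.\<close>
    show ?thesis
    proof (cases "(g d)\<^sup>2 \<le> k d")
      case True
      \<comment> \<open>\<open>k\<close> still dominates at \<open>d\<close>, hence everywhere, and
        \<open>e = d\<close> serves.\<close>
      have "(g x)\<^sup>2 \<le> k x" if x: "c \<le> x" "x \<le> d" for x
      proof -
        have "(g x)\<^sup>2 \<le> (g d)\<^sup>2"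
          using gmono[of x d] gmono[of c x] x gc by (intro power_mono) auto
        also have "\<dots> \<le> k x" using True monotone_onD[OF km, of x d] x by simp
        finally show ?thesis .
      qed
      with one[of d] cd have "d - c \<le> R - 1 / g d" by simp
      then have "d - c \<le> R" using gd by linarith
      moreover have "1 / g d \<le> R" using I0[of c d] cd by (simp add: R_def)
      ultimately show ?thesis using cd by auto
    next
      case False
      \<comment> \<open>Growth from \<open>g c = 0\<close> to \<open>g d > 0\<close> forces
        \<open>k c > 0\<close>, so \<open>g\<^sup>2 - k\<close> starts out negative and the crossing
        lies strictly to the right of \<open>c\<close>.\<close>
      have "g d - g c \<le> k c * (d - c)"
        by (rule derivative_le_imp_increment_le[OF g])
           (use cd in \<open>auto intro!: monotone_onD[OF km]\<close>)
      with gpos[of d] gc cd have "0 < k c * (d - c)" by simp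
      with cd have kc: "0 < k c" by (simp add: zero_less_mult_iff)
      have "\<exists>e\<ge>c. e \<le> d \<and> (g e)\<^sup>2 - k e = 0"
        by (rule IVT') (use False cd kc gc in \<open>auto intro!: continuous_intros cg k\<close>)
      then obtain e where e: "c \<le> e" "e \<le> d" "k e = (g e)\<^sup>2" by force
      then have ce: "c < e" using kc gc by (cases "c = e") auto
      have "(g x)\<^sup>2 \<le> k x" if x: "c \<le> x" "x \<le> e" for x
      proof -
        have "(g x)\<^sup>2 \<le> (g e)\<^sup>2"
          using gmono[of x e] gmono[of c x] x gc e by (intro power_mono) auto
        also have "\<dots> \<le> k x" using e monotone_onD[OF km, of x e] x by simp
        finally show ?thesis .
      qed
      note 1 = one[OF e(1,2) this]
      \<comment> \<open>Past the crossing the minimum is the ratio itself, which is the derivative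
        of \<open>- (1 / g)\<close>; its integral over \<open>{e..d}\<close> is therefore
        \<open>1 / g e - 1 / g d\<close>.\<close>
      have le: "k x \<le> (g x)\<^sup>2" if x: "e \<le> x" "x \<le> d" for x
      proof -
        have "k x \<le> (g e)\<^sup>2" using e monotone_onD[OF km, of e x] x by simp
        also have "\<dots> \<le> (g x)\<^sup>2"
          using gmono[of e x] gpos[OF ce e(2)] x e by (intro power_mono) auto
        finally show ?thesis .
      qed
      have gne: "g x \<noteq> 0" if "x \<in> {e..d}" for x
        using gpos[of x] that ce by auto
      have "((\<lambda>x. - (1 / g x)) has_real_derivative k x / (g x)\<^sup>2) (at x within {e..d})"
        if x: "x \<in> {e..d}" for x
      proof -
        have "(g has_real_derivative k x) (at x within {e..d})"
          using DERIV_subset[OF g[of x], of "{e..d}"] x ce by auto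
        then show ?thesis
          by (auto intro!: derivative_eq_intros simp: gne[OF x] power2_eq_square)
      qed
      then have "((\<lambda>x. k x / (g x)\<^sup>2) has_integral - (1 / g d) - - (1 / g e)) {e..d}"
        by (rule has_integral_derivative_subinterval) (use e in auto)
      then have "integral {e..d} (\<lambda>x. k x / (g x)\<^sup>2) = 1 / g e - 1 / g d"
        by (simp add: integral_unique)
      moreover have "integral {e..d} (\<lambda>x. min_ratio (g x) (k x)) = integral {e..d} (\<lambda>x. k x / (g x)\<^sup>2)"
        by (rule integral_cong) (use le gne kpos e(1) in \<open>auto intro!: min_ratio_eq_ratio\<close>)
      ultimately have "1 / g e \<le> R" using split[OF e(1,2)] I0[of c e] e by simp
      moreover have "e - c \<le> R" using 1 I0[OF e(1,2) order_refl] gd by linarith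
      ultimately show ?thesis using ce e(2) by auto
    qed
  qed
qed

text \<open>Multiplying \<open>g\<close> and \<open>k\<close> by the sign of \<open>k\<close> makes
  \<open>g\<close> increase from its zero, hence positive, and reduces this to
  \<open>cutoff_near_zero_pos\<close>.\<close>

lemma cutoff_right_of_zero:
  fixes g k :: "real \<Rightarrow> real"
  assumes cd: "c < d"
    and g: "\<And>x. x \<in> {c..d} \<Longrightarrow> (g has_real_derivative k x) (at x within {c..d})"
    and k: "continuous_on {c..d} k"
    and gc: "g c = 0" and nz: "\<And>x. c < x \<Longrightarrow> x \<le> d \<Longrightarrow> g x \<noteq> 0"
    and sgn: "(\<forall>x\<in>{c..d}. 0 \<le> k x) \<or> (\<forall>x\<in>{c..d}. k x \<le> 0)"
    and mono: "mono_on {c..d} k \<or> antimono_on {c..d} k"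
    and int: "(\<lambda>x. min_ratio (g x) (k x)) integrable_on {c..d}"
  defines "R \<equiv> integral {c..d} (\<lambda>x. min_ratio (g x) (k x)) + 1 / \<bar>g d\<bar>"
  shows "\<exists>e. c < e \<and> e \<le> d \<and> e - c \<le> R \<and> 1 / \<bar>g e\<bar> \<le> R"
proof -
  have pos: "\<exists>e. c < e \<and> e \<le> d \<and> e - c \<le> R \<and> 1 / \<bar>g e\<bar> \<le> R"
    if s: "s = 1 \<or> s = -1" and ks: "\<And>x. x \<in> {c..d} \<Longrightarrow> 0 \<le> s * k x" for s :: real
  proof -
    have der: "((\<lambda>x. s * g x) has_real_derivative s * k x) (at x within {c..d})"
      if "x \<in> {c..d}" for x
      by (rule DERIV_cmult[OF g[OF that]])
    have gpos: "0 < s * g x" if x: "c < x" "x \<le> d" for x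
      using derivative_nonneg_imp_le[OF der ks, of c x] x gc nz[OF x] s by auto
    have mr: "min_ratio (s * g x) (s * k x) = min_ratio (g x) (k x)" for x
      using s by (auto simp: min_ratio_minus)
    have "mono_on {c..d} (\<lambda>x. s * k x) \<or> antimono_on {c..d} (\<lambda>x. s * k x)"
      using mono s by (auto simp: monotone_on_def)
    then have "\<exists>e. c < e \<and> e \<le> d
        \<and> e - c \<le> integral {c..d} (\<lambda>x. min_ratio (g x) (k x)) + 1 / (s * g d)
        \<and> 1 / (s * g e) \<le> integral {c..d} (\<lambda>x. min_ratio (g x) (k x)) + 1 / (s * g d)"
      using cutoff_near_zero_pos[OF cd der, unfolded mr] gc gpos ks int
      by (simp add: continuous_on_mult_left k)
    moreover have "s * g x = \<bar>g x\<bar>" if "c < x" "x \<le> d" for x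
      using gpos[OF that] s by auto
    ultimately show ?thesis using cd unfolding R_def by auto
  qed
  from sgn show ?thesis
    using pos[of 1] pos[of "-1"] by auto
qed

text \<open>The reflection of \<open>cutoff_right_of_zero\<close> under \<open>x\<close> to
  \<open>- x\<close>.\<close>

lemma cutoff_left_of_zero:
  fixes g k :: "real \<Rightarrow> real"
  assumes cd: "c < d"
    and g: "\<And>x. x \<in> {c..d} \<Longrightarrow> (g has_real_derivative k x) (at x within {c..d})"
    and k: "continuous_on {c..d} k"
    and gd: "g d = 0" and nz: "\<And>x. c \<le> x \<Longrightarrow> x < d \<Longrightarrow> g x \<noteq> 0"
    and sgn: "(\<forall>x\<in>{c..d}. 0 \<le> k x) \<or> (\<forall>x\<in>{c..d}. k x \<le> 0)"
    and mono: "mono_on {c..d} k \<or> antimono_on {c..d} k"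
    and int: "(\<lambda>x. min_ratio (g x) (k x)) integrable_on {c..d}"
  defines "R \<equiv> integral {c..d} (\<lambda>x. min_ratio (g x) (k x)) + 1 / \<bar>g c\<bar>"
  shows "\<exists>e. c \<le> e \<and> e < d \<and> d - e \<le> R \<and> 1 / \<bar>g e\<bar> \<le> R"
proof -
  have der: "((\<lambda>x. g (- x)) has_real_derivative - k (- x)) (at x within {-d..-c})"
    if "x \<in> {-d..-c}" for x
  proof -
    have "(g has_real_derivative k (- x)) (at (- x) within uminus ` {-d..-c})"
      using g[of "- x"] that by simp
    moreover have "(uminus has_real_derivative -1) (at x within {-d..-c})"
      by (auto intro!: derivative_eq_intros)
    ultimately show ?thesis
      using DERIV_image_chain[of g "k (- x)" uminus x "{-d..-c}" "-1"] by (simp add: o_def)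
  qed
  have ck: "continuous_on {-d..-c} (\<lambda>x. - k (- x))"
    by (intro continuous_intros continuous_on_compose2[OF k]) auto
  have sg: "(\<forall>x\<in>{-d..-c}. 0 \<le> - k (- x)) \<or> (\<forall>x\<in>{-d..-c}. - k (- x) \<le> 0)"
    using sgn by auto
  have mo: "mono_on {-d..-c} (\<lambda>x. - k (- x)) \<or> antimono_on {-d..-c} (\<lambda>x. - k (- x))"
    using mono by (auto simp: monotone_on_def)
  have it: "(\<lambda>x. min_ratio (g (- x)) (- k (- x))) integrable_on {-d..-c}"
    using int by (simp add: min_ratio_minus_right
        Henstock_Kurzweil_Integration.integrable_reflect_real[where f = "\<lambda>x. min_ratio (g x) (k x)"])
  have ir: "integral {-d..-c} (\<lambda>x. min_ratio (g (- x)) (- k (- x)))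
      = integral {c..d} (\<lambda>x. min_ratio (g x) (k x))"
    by (simp add: min_ratio_minus_right
        Henstock_Kurzweil_Integration.integral_reflect_real[where f = "\<lambda>x. min_ratio (g x) (k x)"])
  have "\<exists>e>-d. e \<le> -c \<and> e - -d \<le> R \<and> 1 / \<bar>g (- e)\<bar> \<le> R"
    using cutoff_right_of_zero[OF _ der ck _ _ sg mo it] cd gd nz unfolding ir R_def by simp
  then obtain e where "-d < e" "e \<le> -c" "e - -d \<le> R" "1 / \<bar>g (- e)\<bar> \<le> R" by blast
  then show ?thesis by (intro exI[of _ "- e"]) auto
qed

section \<open>The estimate on a single piece\<close>

text \<open>Constant signs of \<open>k\<close> and \<open>q\<close> make \<open>g\<close> and
  \<open>k\<close> monotone, so integration by parts and the cutoff both apply. At an end where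
  \<open>g\<close> vanishes, \<open>1 / 0 = 0\<close> removes the corresponding term, and the bound
  charges only the other end.\<close>

lemma oscillatory_bound_between_critical_points:
  fixes f g k q :: "real \<Rightarrow> real" and \<phi> \<phi>' :: "real \<Rightarrow> complex"
  assumes cd: "c < d"
    and f: "\<And>x. x \<in> {c..d} \<Longrightarrow> (f has_real_derivative g x) (at x within {c..d})"
    and g: "\<And>x. x \<in> {c..d} \<Longrightarrow> (g has_real_derivative k x) (at x within {c..d})"
    and k: "\<And>x. x \<in> {c..d} \<Longrightarrow> (k has_real_derivative q x) (at x within {c..d})"
    and q: "continuous_on {c..d} q"
    and \<phi>: "\<And>x. x \<in> {c..d} \<Longrightarrow> (\<phi> has_vector_derivative \<phi>' x) (at x within {c..d})"
    and \<phi>': "continuous_on {c..d} \<phi>'"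
    and nz: "\<And>x. c < x \<Longrightarrow> x < d \<Longrightarrow> g x \<noteq> 0 \<and> k x \<noteq> 0 \<and> q x \<noteq> 0"
    and M: "\<And>x. x \<in> {c..d} \<Longrightarrow> cmod (\<phi> x) \<le> M"
    and int: "(\<lambda>x. min_ratio (g x) (k x)) integrable_on {c..d}"
  shows "cmod (integral {c..d} (\<lambda>x. exp (\<i> * complex_of_real (f x)) * \<phi> x))
    \<le> 5 * (M + integral {c..d} (\<lambda>x. cmod (\<phi>' x)))
      * (integral {c..d} (\<lambda>x. min_ratio (g x) (k x)) + 1 / \<bar>g c\<bar> + 1 / \<bar>g d\<bar>)"
proof -
  define u where "u x = exp (\<i> * complex_of_real (f x)) * \<phi> x" for x
  define V where "V = integral {c..d} (\<lambda>x. cmod (\<phi>' x))"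
  define I where "I = integral {c..d} (\<lambda>x. min_ratio (g x) (k x))"
  define K where "K = M + V"
  have ck: "continuous_on {c..d} k" using k DERIV_continuous_on by blast
  have cu: "continuous_on {c..d} u"
    unfolding u_def using f DERIV_continuous_on continuous_on_vector_derivative[of _ \<phi>, OF \<phi>]
    by (intro continuous_intros) blast+
  have pint: "(\<lambda>x. cmod (\<phi>' x)) integrable_on {c..d}"
    by (intro integrable_continuous_real continuous_intros \<phi>')
  have V0: "0 \<le> V" unfolding V_def by (rule integral_nonneg[OF pint]) simp
  have M0: "0 \<le> M" using M[of c] cd order_trans[OF norm_ge_zero] by auto
  have K0: "0 \<le> K" and MK: "M \<le> K" using V0 M0 by (auto simp: K_def)
  have I0: "0 \<le> I" unfolding I_def by (rule integral_nonneg[OF int]) (rule min_ratio_nonneg)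
  have ksgn: "(\<forall>x\<in>{c..d}. 0 \<le> k x) \<or> (\<forall>x\<in>{c..d}. k x \<le> 0)"
    by (rule nonvanishing_imp_constant_sign[OF ck]) (use nz in auto)
  have "(\<forall>x\<in>{c..d}. 0 \<le> q x) \<or> (\<forall>x\<in>{c..d}. q x \<le> 0)"
    by (rule nonvanishing_imp_constant_sign[OF q]) (use nz in auto)
  then have kmono: "mono_on {c..d} k \<or> antimono_on {c..d} k"
  proof
    assume "\<forall>x\<in>{c..d}. 0 \<le> q x"
    then have "k x \<le> k y" if "c \<le> x" "x \<le> y" "y \<le> d" for x y
      using derivative_nonneg_imp_le[OF k, of x y] that by blast
    then show ?thesis by (auto simp: monotone_on_def)
  next
    assume neg: "\<forall>x\<in>{c..d}. q x \<le> 0"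
    have "((\<lambda>x. - k x) has_real_derivative - q x) (at x within {c..d})" if "x \<in> {c..d}" for x
      by (rule DERIV_minus[OF k[OF that]])
    then have "- k x \<le> - k y" if "c \<le> x" "x \<le> y" "y \<le> d" for x y
      by (rule derivative_nonneg_imp_le) (use that neg in auto)
    then show ?thesis by (auto simp: monotone_on_def)
  qed
  have parts: "cmod (integral {x..y} u) \<le> 2 * K * (1 / \<bar>g x\<bar> + 1 / \<bar>g y\<bar>)"
    if xy: "c \<le> x" "x \<le> y" "y \<le> d" and gnz: "\<And>z. z \<in> {x..y} \<Longrightarrow> g z \<noteq> 0" for x y
  proof -
    have sub: "{x..y} \<subseteq> {c..d}" using xy by auto
    have "integral {x..y} (\<lambda>x. cmod (\<phi>' x)) \<le> V"
      unfolding V_def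
      by (rule integral_subset_le[OF sub integrable_subinterval_real[OF pint sub] pint]) simp
    then have "2 * (M + integral {x..y} (\<lambda>x. cmod (\<phi>' x))) * (1 / \<bar>g x\<bar> + 1 / \<bar>g y\<bar>)
        \<le> 2 * K * (1 / \<bar>g x\<bar> + 1 / \<bar>g y\<bar>)"
      by (intro mult_right_mono) (auto simp: K_def)
    moreover have "cmod (integral {x..y} u)
        \<le> 2 * (M + integral {x..y} (\<lambda>x. cmod (\<phi>' x))) * (1 / \<bar>g x\<bar> + 1 / \<bar>g y\<bar>)"
      unfolding u_def
    proof (rule first_derivative_test_oscillatory[OF xy(2)])
      show "continuous_on {x..y} k" "continuous_on {x..y} \<phi>'"
        using ck \<phi>' sub continuous_on_subset by blast+
      show "(\<forall>x\<in>{x..y}. 0 \<le> k x) \<or> (\<forall>x\<in>{x..y}. k x \<le> 0)"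
        using ksgn sub by blast
    qed (use sub in \<open>auto simp: gnz intro: DERIV_subset[OF f] DERIV_subset[OF g] M
           has_vector_derivative_within_subset[OF \<phi>]\<close>)
    ultimately show ?thesis by linarith
  qed
  have trivial: "cmod (integral {x..y} u) \<le> K * (y - x)"
    if xy: "c \<le> x" "x \<le> y" "y \<le> d" for x y
  proof (rule integral_bound[OF xy(2)])
    show "continuous_on {x..y} u" using cu by (rule continuous_on_subset) (use xy in auto)
    show "cmod (u t) \<le> K" if "t \<in> {x..y}" for t
      using M[of t] MK that xy by (simp add: u_def norm_mult)
  qed
  have split: "cmod (integral {c..d} u) \<le> cmod (integral {c..e} u) + cmod (integral {e..d} u)"
    if "c \<le> e" "e \<le> d" for e
    using Henstock_Kurzweil_Integration.integral_combine[OF that integrable_continuous_real[OF cu]]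
      norm_triangle_ineq by metis
  have mid: "c < (c + d) / 2" "(c + d) / 2 < d" using cd by auto
  \<comment> \<open>A monotone \<open>g\<close> that vanishes at both ends would also vanish at the
    midpoint.\<close>
  have not_both: "g c \<noteq> 0 \<or> g d \<noteq> 0"
  proof (rule ccontr)
    assume eq: "\<not> ?thesis"
    from ksgn have "g ((c + d) / 2) = 0"
    proof
      assume "\<forall>x\<in>{c..d}. 0 \<le> k x"
      then show ?thesis
        using derivative_nonneg_imp_le[OF g, of c "(c + d) / 2"]
          derivative_nonneg_imp_le[OF g, of "(c + d) / 2" d] mid eq by auto
    next
      assume neg: "\<forall>x\<in>{c..d}. k x \<le> 0"
      have "((\<lambda>x. - g x) has_real_derivative - k x) (at x within {c..d})" if "x \<in> {c..d}" for x
        by (rule DERIV_minus[OF g[OF that]])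
      from derivative_nonneg_imp_le[OF this, of c "(c + d) / 2"]
        derivative_nonneg_imp_le[OF this, of "(c + d) / 2" d]
      show ?thesis using neg mid eq by auto
    qed
    with nz mid show False by blast
  qed
  \<comment> \<open>If \<open>g\<close> vanishes at one end, this is exactly the \<open>R\<close> of
    the cutoff lemmas, the term at that end being 0.\<close>
  define R where "R = I + 1 / \<bar>g c\<bar> + 1 / \<bar>g d\<bar>"
  have R0: "0 \<le> R" and gR: "1 / \<bar>g c\<bar> \<le> R" "1 / \<bar>g d\<bar> \<le> R" using I0 by (simp_all add: R_def)
  \<comment> \<open>The constant is \<open>5 = 1 + 2 * 2\<close>: the trivial bound near the zero,
    and two end values from integration by parts, each with factor 2.\<close>
  have comb: "cmod (integral {c..d} u) \<le> 5 * K * R"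
    if "cmod (integral {c..d} u) \<le> K * s + 2 * K * (r + t)" "s \<le> R" "r \<le> R" "t \<le> R" for s r t
  proof -
    have "K * s + 2 * K * (r + t) \<le> K * R + 2 * K * (R + R)"
      using that K0 by (intro add_mono mult_left_mono) auto
    with that(1) show ?thesis by (simp add: algebra_simps)
  qed
  consider "g c \<noteq> 0" "g d \<noteq> 0" | "g c = 0" "g d \<noteq> 0" | "g c \<noteq> 0" "g d = 0"
    using not_both by blast
  then have "cmod (integral {c..d} u) \<le> 5 * K * R"
  proof cases
    case 1
    then have "g z \<noteq> 0" if "z \<in> {c..d}" for z
      using nz[of z] that by (cases "z = c"; cases "z = d") auto
    then show ?thesis
      using comb[of 0 "1 / \<bar>g c\<bar>" "1 / \<bar>g d\<bar>"] parts[of c d] cd R0 gR by simp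
  next
    case 2
    then have gz: "g z \<noteq> 0" if "c < z" "z \<le> d" for z
      using nz[of z] that by (cases "z = d") auto
    obtain e where e: "c < e" "e \<le> d" "e - c \<le> R" "1 / \<bar>g e\<bar> \<le> R"
      using cutoff_right_of_zero[OF cd g ck 2(1) gz ksgn kmono int] 2(1)
      by (auto simp: R_def I_def)
    have "cmod (integral {e..d} u) \<le> 2 * K * (1 / \<bar>g e\<bar> + 1 / \<bar>g d\<bar>)"
      by (rule parts) (use e gz in auto)
    then show ?thesis
      using comb[OF _ e(3,4) gR(2)] split[of e] trivial[of c e] e by simp
  next
    case 3
    then have gz: "g z \<noteq> 0" if "c \<le> z" "z < d" for z
      using nz[of z] that by (cases "z = c") auto
    obtain e where e: "c \<le> e" "e < d" "d - e \<le> R" "1 / \<bar>g e\<bar> \<le> R"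
      using cutoff_left_of_zero[OF cd g ck 3(2) gz ksgn kmono int] 3(2)
      by (auto simp: R_def I_def)
    have "cmod (integral {c..e} u) \<le> 2 * K * (1 / \<bar>g c\<bar> + 1 / \<bar>g e\<bar>)"
      by (rule parts) (use e gz in auto)
    then show ?thesis
      using comb[OF _ e(3) gR(1) e(4)] split[of e] trivial[of e d] e by simp
  qed
  then show ?thesis unfolding u_def K_def V_def R_def I_def .
qed

section \<open>Summation over the pieces\<close>

text \<open>Induction on the number of points of \<open>P\<close> inside: split at one of them and
  add the bounds for both halves. The splitting point is an end of either half, whence the factor 2
  for interior points.\<close>

lemma norm_integral_le_of_partition:
  fixes u :: "real \<Rightarrow> 'a::banach" and v w :: "real \<Rightarrow> real"
  assumes P: "finite P" and ab: "a < b"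
    and u: "u integrable_on {a..b}" and v: "v integrable_on {a..b}"
    and piece: "\<And>c d. a \<le> c \<Longrightarrow> c < d \<Longrightarrow> d \<le> b \<Longrightarrow> {c<..<d} \<inter> P = {} \<Longrightarrow>
      norm (integral {c..d} u) \<le> A * (integral {c..d} v + w c + w d)"
  shows "norm (integral {a..b} u) \<le> A * (integral {a..b} v + w a + w b + 2 * sum w ({a<..<b} \<inter> P))"
proof -
  have "norm (integral {c..d} u) \<le> A * (integral {c..d} v + w c + w d + 2 * sum w ({c<..<d} \<inter> P))"
    if "a \<le> c" "c < d" "d \<le> b" for c d
    using that
  proof (induction "card ({c<..<d} \<inter> P)" arbitrary: c d rule: less_induct)
    case less
    show ?case
    proof (cases "{c<..<d} \<inter> P = {}")
      case True
      with piece[of c d] less.prems show ?thesis by simp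
    next
      case False
      then obtain p where p: "c < p" "p < d" "p \<in> P" by auto
      have fin: "finite ({x<..<y} \<inter> P)" for x y using P by simp
      have "norm (integral {c..p} u) \<le> A * (integral {c..p} v + w c + w p + 2 * sum w ({c<..<p} \<inter> P))"
        by (rule less.hyps) (use p less.prems in \<open>auto intro!: psubset_card_mono fin\<close>)
      moreover have "norm (integral {p..d} u) \<le> A * (integral {p..d} v + w p + w d + 2 * sum w ({p<..<d} \<inter> P))"
        by (rule less.hyps) (use p less.prems in \<open>auto intro!: psubset_card_mono fin\<close>)
      moreover have "integral {c..p} u + integral {p..d} u = integral {c..d} u"
        by (rule Henstock_Kurzweil_Integration.integral_combine)
           (use p less.prems in \<open>auto intro: integrable_subinterval_real[OF u]\<close>)
      moreover have "integral {c..d} v = integral {c..p} v + integral {p..d} v"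
        by (rule Henstock_Kurzweil_Integration.integral_combine[symmetric])
           (use p less.prems in \<open>auto intro: integrable_subinterval_real[OF v]\<close>)
      moreover have "sum w ({c<..<d} \<inter> P) = w p + (sum w ({c<..<p} \<inter> P) + sum w ({p<..<d} \<inter> P))"
      proof -
        have "{c<..<d} \<inter> P = insert p (({c<..<p} \<inter> P) \<union> ({p<..<d} \<inter> P))" using p by auto
        moreover have "sum w (({c<..<p} \<inter> P) \<union> ({p<..<d} \<inter> P))
            = sum w ({c<..<p} \<inter> P) + sum w ({p<..<d} \<inter> P)"
          by (rule sum.union_disjoint) (use fin in auto)
        ultimately show ?thesis using fin by simp
      qed
      ultimately show ?thesis
        using norm_triangle_ineq[of "integral {c..p} u" "integral {p..d} u"]
        by (simp add: algebra_simps)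
    qed
  qed
  with ab show ?thesis by simp
qed

section \<open>The two norms of the amplitude\<close>

text \<open>The bound by the essential supremum holds almost everywhere; by continuity the set where
  it holds is closed, so it contains the open interval and then its closure.\<close>

lemma norm_le_Linf_norm:
  fixes h :: "real \<Rightarrow> 'a::real_normed_vector"
  assumes ab: "a < b" and h: "continuous_on {a..b} h" and x: "x \<in> {a..b}"
  shows "norm (h x) \<le> Linf_norm {a..b} h"
proof -
  let ?M = "lebesgue_on {a..b}"
  let ?F = "\<lambda>x. ereal (norm (h x))"
  have meas: "?F \<in> borel_measurable ?M"
    by (intro borel_measurable_ereal continuous_imp_measurable_on_sets_lebesgue
        continuous_on_norm h) simp
  obtain C where C: "\<And>y. y \<in> {a..b} \<Longrightarrow> norm (h y) \<le> C"
    using compact_imp_bounded[OF compact_continuous_image[OF h]] unfolding bounded_iff by blast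
  \<comment> \<open>Both bounds show that the essential supremum is finite, so
    \<open>real_of_ereal\<close> does not replace it by a default value. The lower one rests on the
    positive measure of the interval.\<close>
  have "esssup ?M ?F \<le> ereal C"
    by (rule esssup_I[OF meas AE_I2]) (use C in auto)
  moreover have "0 \<le> esssup ?M ?F"
  proof -
    have "emeasure ?M (space ?M) \<noteq> 0"
      using ab by (simp add: emeasure_restrict_space)
    then have "esssup ?M (\<lambda>x. 0) = (0::ereal)" by (rule esssup_const)
    moreover have "esssup ?M (\<lambda>x. 0) \<le> esssup ?M ?F" by (rule esssup_mono) auto
    ultimately show ?thesis by simp
  qed
  ultimately have L: "esssup ?M ?F = ereal (Linf_norm {a..b} h)"
    unfolding Linf_norm_def by (intro ereal_real'[symmetric]) auto
  define C where "C = {y \<in> {a..b}. norm (h y) \<le> Linf_norm {a..b} h}"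
  have "C = {a..b} \<inter> (\<lambda>y. norm (h y)) -` {..Linf_norm {a..b} h}" by (auto simp: C_def)
  then have cl: "closed C"
    by (simp add: continuous_closed_preimage continuous_on_norm h)
  have "AE y in ?M. ?F y \<le> esssup ?M ?F" by (rule esssup_AE)
  then have "AE y in ?M. norm (h y) \<le> Linf_norm {a..b} h" unfolding L by simp
  then have "AE y \<in> {a..b} in lebesgue. norm (h y) \<le> Linf_norm {a..b} h"
    by (subst (asm) AE_restrict_space_iff) auto
  then have "AE y \<in> {a<..<b} in lebesgue. y \<in> C" by (auto simp: C_def)
  from mem_closed_if_AE_lebesgue_open[OF open_greaterThanLessThan cl this]
  have "{a<..<b} \<subseteq> C" by (rule subsetI)
  then have "closure {a<..<b} \<subseteq> C" using cl by (rule closure_minimal)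
  with ab x show ?thesis by (auto simp: C_def)
qed

text \<open>Passes from the Lebesgue integral in \<open>L1_norm\<close> to the gauge integral of the
  other estimates.\<close>

lemma L1_norm_eq_integral:
  fixes h :: "real \<Rightarrow> 'a::euclidean_space"
  assumes "continuous_on {a..b} h"
  shows "L1_norm {a..b} h = integral {a..b} (\<lambda>x. norm (h x))"
  unfolding L1_norm_def
  by (intro lebesgue_integral_eq_integral continuous_imp_integrable_real continuous_on_norm assms) simp

section \<open>The estimate on the whole interval\<close>

theorem theorem1p2:
  shows "\<exists>B>0::real. \<forall>(a::real) (b::real) (f :: real \<Rightarrow> real) (\<phi> :: real \<Rightarrow> complex).
    a < b \<longrightarrow>
    C_k_on 3 {a..b} f \<longrightarrow>
    finite {x \<in> {a..b}. (deriv_on {a..b} ^^ 3) f x = 0} \<longrightarrow>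
    C_k_on 1 {a..b} \<phi> \<longrightarrow>
    cmod (integral {a..b} (\<lambda>x. exp (\<i> * complex_of_real (f x)) * \<phi> x))
      \<le> B * (Linf_norm {a..b} \<phi> + L1_norm {a..b} (deriv_on {a..b} \<phi>)) *
        (integral {a..b} (\<lambda>x. min_ratio (deriv_on {a..b} f x) ((deriv_on {a..b} ^^ 2) f x))
         + min (b - a) (\<Sum>x\<in>J_set a b f. 1 / \<bar>deriv_on {a..b} f x\<bar>))"
\<comment> \<open>\<open>10 = 2 * 5\<close>: the constant 5 of a single piece, doubled because a
  point of \<open>J\<close> can be an end of two pieces.\<close>
proof (intro exI[of _ 10] conjI allI impI)
  fix a b :: real and f :: "real \<Rightarrow> real" and \<phi> :: "real \<Rightarrow> complex"
  assume ab: "a < b" and Cf: "C_k_on 3 {a..b} f"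
    and fin: "finite {x \<in> {a..b}. (deriv_on {a..b} ^^ 3) f x = 0}"
    and Cphi: "C_k_on 1 {a..b} \<phi>"
  define g where "g = deriv_on {a..b} f"
  define k where "k = (deriv_on {a..b} ^^ 2) f"
  define q where "q = (deriv_on {a..b} ^^ 3) f"
  define \<phi>' where "\<phi>' = deriv_on {a..b} \<phi>"
  define M where "M = Linf_norm {a..b} \<phi>"
  define V where "V = integral {a..b} (\<lambda>x. cmod (\<phi>' x))"
  define u where "u x = exp (\<i> * complex_of_real (f x)) * \<phi> x" for x
  define I where "I = integral {a..b} (\<lambda>x. min_ratio (g x) (k x))"
  define w where "w x = 1 / \<bar>g x\<bar>" for x
  have f: "(f has_real_derivative g x) (at x within {a..b})"
    and g: "(g has_real_derivative k x) (at x within {a..b})"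
    and k: "(k has_real_derivative q x) (at x within {a..b})" if "x \<in> {a..b}" for x
    using C_k_on_has_vector_derivative[OF Cf _ that, of 0]
      C_k_on_has_vector_derivative[OF Cf _ that, of 1]
      C_k_on_has_vector_derivative[OF Cf _ that, of 2]
    by (simp_all add: g_def k_def q_def has_real_derivative_iff_has_vector_derivative eval_nat_numeral)
  have phi: "(\<phi> has_vector_derivative \<phi>' x) (at x within {a..b})" if "x \<in> {a..b}" for x
    using C_k_on_has_vector_derivative[OF Cphi _ that, of 0] by (simp add: \<phi>'_def)
  have cq: "continuous_on {a..b} q" and cphi': "continuous_on {a..b} \<phi>'"
    using Cf Cphi by (simp_all add: C_k_on_def q_def \<phi>'_def)
  have cphi: "continuous_on {a..b} \<phi>" using phi by (rule continuous_on_vector_derivative)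
  have cf: "continuous_on {a..b} f" using f DERIV_continuous_on by blast
  have cu: "continuous_on {a..b} u"
    unfolding u_def by (intro continuous_intros cf cphi)
  have M: "cmod (\<phi> x) \<le> M" if "x \<in> {a..b}" for x
    unfolding M_def by (rule norm_le_Linf_norm[OF ab cphi that])
  have M0: "0 \<le> M" using M[of a] ab order_trans[OF norm_ge_zero] by auto
  have pint: "(\<lambda>x. cmod (\<phi>' x)) integrable_on {a..b}"
    by (intro integrable_continuous_real continuous_intros cphi')
  have V0: "0 \<le> V" unfolding V_def by (rule integral_nonneg[OF pint]) simp
  have vint: "(\<lambda>x. min_ratio (g x) (k x)) integrable_on {a..b}"
    using integrable_min_ratio[OF Cf] by (simp add: g_def k_def)
  have I0: "0 \<le> I" unfolding I_def by (rule integral_nonneg[OF vint]) (rule min_ratio_nonneg)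
  \<comment> \<open>By Rolle's theorem finiteness of the zeros descends from \<open>q\<close> to
    \<open>k\<close> and then to \<open>g\<close>.\<close>
  have fink: "finite {x \<in> {a..b}. k x = 0}"
    by (rule finite_zeros_of_finite_deriv_zeros[of a b k q])
       (use k fin in \<open>auto simp: has_real_derivative_iff_has_vector_derivative q_def\<close>)
  then have fing: "finite {x \<in> {a..b}. g x = 0}"
    by (rule finite_zeros_of_finite_deriv_zeros[rotated])
       (use g in \<open>auto simp: has_real_derivative_iff_has_vector_derivative\<close>)
  define P where "P = {x \<in> {a..b}. g x = 0} \<union> {x \<in> {a..b}. k x = 0} \<union> {x \<in> {a..b}. q x = 0}"
  have finP: "finite P" using fing fink fin by (simp add: P_def q_def)
  have main: "cmod (integral {a..b} u)
      \<le> 5 * (M + V) * (I + w a + w b + 2 * sum w ({a<..<b} \<inter> P))"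
    unfolding I_def
  proof (rule norm_integral_le_of_partition[OF finP ab integrable_continuous_real[OF cu] vint])
    fix c d assume cd: "a \<le> c" "c < d" "d \<le> b" "{c<..<d} \<inter> P = {}"
    have sub: "{c..d} \<subseteq> {a..b}" using cd by auto
    have "cmod (integral {c..d} u) \<le> 5 * (M + integral {c..d} (\<lambda>x. cmod (\<phi>' x)))
        * (integral {c..d} (\<lambda>x. min_ratio (g x) (k x)) + 1 / \<bar>g c\<bar> + 1 / \<bar>g d\<bar>)"
      unfolding u_def
    proof (rule oscillatory_bound_between_critical_points[OF cd(2)])
      show "continuous_on {c..d} q" "continuous_on {c..d} \<phi>'"
        using cq cphi' sub continuous_on_subset by blast+
      show "(\<lambda>x. min_ratio (g x) (k x)) integrable_on {c..d}"
        by (rule integrable_subinterval_real[OF vint sub])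
      show "g x \<noteq> 0 \<and> k x \<noteq> 0 \<and> q x \<noteq> 0" if "c < x" "x < d" for x
        using cd that unfolding P_def by (auto simp: disjoint_iff)
    qed (use sub in \<open>auto intro: DERIV_subset[OF f] DERIV_subset[OF g] DERIV_subset[OF k] M
           has_vector_derivative_within_subset[OF phi]\<close>)
    \<comment> \<open>Enlarging the integral of \<open>cmod (\<phi>' x)\<close> to all of
      \<open>{a..b}\<close> gives every piece the same factor, as the summation requires.\<close>
    also have "\<dots> \<le> 5 * (M + V)
        * (integral {c..d} (\<lambda>x. min_ratio (g x) (k x)) + 1 / \<bar>g c\<bar> + 1 / \<bar>g d\<bar>)"
    proof (rule mult_right_mono)
      have "integral {c..d} (\<lambda>x. cmod (\<phi>' x)) \<le> V"
        unfolding V_def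
        by (rule integral_subset_le[OF sub integrable_subinterval_real[OF pint sub] pint]) simp
      then show "5 * (M + integral {c..d} (\<lambda>x. cmod (\<phi>' x))) \<le> 5 * (M + V)" by simp
      show "0 \<le> integral {c..d} (\<lambda>x. min_ratio (g x) (k x)) + 1 / \<bar>g c\<bar> + 1 / \<bar>g d\<bar>"
        by (intro add_nonneg_nonneg integral_nonneg integrable_subinterval_real[OF vint sub])
           (auto simp: min_ratio_nonneg)
    qed
    finally show "cmod (integral {c..d} u)
        \<le> 5 * (M + V) * (integral {c..d} (\<lambda>x. min_ratio (g x) (k x)) + w c + w d)"
      by (simp add: w_def)
  qed
  define S where "S = sum w (J_set a b f)"
  \<comment> \<open>Zeros of \<open>f'\<close> contribute nothing because \<open>1 / 0 = 0\<close>.\<close>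
  have "S = sum w ({a, b} \<union> ({a<..<b} \<inter> P))"
    unfolding S_def
    by (rule sum.mono_neutral_left)
       (use finP ab in \<open>auto simp: J_set_def P_def g_def k_def q_def w_def\<close>)
  also have "\<dots> = w a + w b + sum w ({a<..<b} \<inter> P)"
    using finP ab by (subst sum.union_disjoint) auto
  finally have S: "S = w a + w b + sum w ({a<..<b} \<inter> P)" .
  have w0: "0 \<le> w x" for x by (simp add: w_def)
  have S0: "0 \<le> S" unfolding S_def by (rule sum_nonneg) (rule w0)
  have "cmod (integral {a..b} u) \<le> 10 * (M + V) * (I + min (b - a) S)"
  \<comment> \<open>If the minimum is \<open>b - a\<close>, the trivial bound suffices; otherwise
    the summed estimate gives \<open>S\<close>.\<close>
  proof (cases "b - a \<le> S")
    case True
    have "cmod (integral {a..b} u) \<le> M * (b - a)"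
      by (rule integral_bound[OF _ cu]) (use ab M in \<open>auto simp: u_def norm_mult\<close>)
    also have "\<dots> \<le> 10 * (M + V) * (I + (b - a))"
      by (rule mult_mono) (use M0 V0 I0 ab in auto)
    finally show ?thesis using True by simp
  next
    case False
    note main
    \<comment> \<open>The ends \<open>a\<close> and \<open>b\<close> are counted once and interior
      points twice, so the total is at most \<open>2 * S\<close>.\<close>
    also have "5 * (M + V) * (I + w a + w b + 2 * sum w ({a<..<b} \<inter> P))
        \<le> 5 * (M + V) * (2 * (I + S))"
      by (rule mult_left_mono) (use S w0[of a] w0[of b] I0 M0 V0 in auto)
    finally show ?thesis using False by (simp add: algebra_simps)
  qed
  then show "cmod (integral {a..b} (\<lambda>x. exp (\<i> * complex_of_real (f x)) * \<phi> x))
      \<le> 10 * (Linf_norm {a..b} \<phi> + L1_norm {a..b} (deriv_on {a..b} \<phi>)) *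
        (integral {a..b} (\<lambda>x. min_ratio (deriv_on {a..b} f x) ((deriv_on {a..b} ^^ 2) f x))
         + min (b - a) (\<Sum>x\<in>J_set a b f. 1 / \<bar>deriv_on {a..b} f x\<bar>))"
    using L1_norm_eq_integral[OF cphi']
    by (simp add: u_def[abs_def] M_def V_def I_def S_def w_def[abs_def] g_def k_def \<phi>'_def)
qed simp

end
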